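(* Let $f(x)\in\mathbb{Z}[x]$ be a monic irreducible polynomial with a complex root $\alpha$ such that $\mathbb{Q}(\alpha)/\mathbb{Q}$ is Galois with group $G$. Let $\chi$ be an absolutely irreducible character of $G$ afforded by a rational matrix representation $A$: there is a minimal left ideal $\mathfrak{m}$ of $\mathbb{Q}[G]c_\chi$ with $\mathbb{Q}$-basis $w_1,\dots,w_{\chi(1)}$ such that $g(w_1,\dots,w_{\chi(1)})=(w_1,\dots,w_{\chi(1)})A(g)$ for all $g\in G$, with $A(g)\in GL_{\chi(1)}(\mathbb{Q})$. Let $v_{i,j}\in\mathbb{Q}[G]c_\chi$ ($1\le i,j\le\chi(1)$) be the elements with $v_{i,j}w_k=\delta_{i,k}w_j$ for all $k$; they form a $\mathbb{Q}$-basis of $\mathbb{Q}[G]c_\chi$. Let $M\in\mathbb{Q}[G]$ satisfy $M=Mc_\chi$ and write $M=\sum_{1\le k,l\le\chi(1)}m_{k,l}v_{l,k}$ with $m_{k,l}\in\mathbb{Q}$. Then $M\in LR(\chi)$ holds if and only if $$(m_{i,j})\Big(\sum_{g\in G}g^{-1}(\alpha)A(g)\Big)=0,$$ and this is moreover equivalent to the vanishing of the product of the matrix $(m_{i,j})$ with the first column of $\sum_{g\in G}g^{-1}(\alpha)A(g)$.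
   Context: $c_\chi:=\chi(1)|G|^{-1}\sum_{g\in G}\overline{\chi(g)}g\in\mathbb{Q}[G]$ (here $\chi$ is rational-valued). $LR(\chi):=\{M\in\mathbb{Q}[G]\mid M=Mc_\chi,\ M\cdot(\sum_{g\in G}g(\alpha)g^{-1})=0\}$, the product taken in the group algebra $\mathbb{C}[G]$. For $g\in G$, $g^{-1}(\alpha)$ is the image of $\alpha$ under the field automorphism $g^{-1}$. *)

theory Defs
  imports
    Complex_Main
    "HOL-Algebra.Bij"
    "HOL-Algebra.AbelCoset"
    "HOL-Algebra.Generated_Fields"
    "HOL-Computational_Algebra.Polynomial_Factorial"
    "Jordan_Normal_Form.VS_Connect"
begin

definition adjoin_rat :: "complex \<Rightarrow> complex set" where
  "adjoin_rat \<alpha> = generate_field class_ring (insert \<alpha> \<rat>)"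

text \<open>
  A subfield \<open>K\<close> of the complex numbers is Galois over the rationals if it is algebraic, normal
  and separable: every irreducible rational polynomial with a root in \<open>K\<close> is a product of
  pairwise distinct linear factors with roots in \<open>K\<close>.
\<close>

definition galois_over_rat :: "complex set \<Rightarrow> bool" where
  "galois_over_rat K \<longleftrightarrow>
     (\<forall>x\<in>K. algebraic x) \<and>
     (\<forall>p :: rat poly. irreducible p \<and> (\<exists>x\<in>K. poly (map_poly of_rat p) x = 0) \<longrightarrow>
        (\<exists>c xs. distinct xs \<and> set xs \<subseteq> K \<and>
           map_poly of_rat p = Polynomial.smult c (\<Prod>x\<leftarrow>xs. [:- x, 1:])))"

definition field_auts :: "complex set \<Rightarrow> (complex \<Rightarrow> complex) set" where
  "field_auts K =
     {\<sigma> \<in> Bij K. (\<forall>x\<in>K. \<forall>y\<in>K. \<sigma> (x + y) = \<sigma> x + \<sigma> y \<and> \<sigma> (x * y) = \<sigma> x * \<sigma> y) \<and>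
                 (\<forall>q\<in>\<rat>. \<sigma> q = q)}"

definition galois_group :: "complex set \<Rightarrow> (complex \<Rightarrow> complex) monoid" where
  "galois_group K = (BijGroup K)\<lparr>carrier := field_auts K\<rparr>"

text \<open>
  The group algebra of a finite group \<open>G\<close> with coefficients in a subfield \<open>K\<close> of the complex
  numbers; the element \<open>\<Sum>g. a\<^sub>g g\<close> is the function \<open>g \<mapsto> a\<^sub>g\<close>, extended by zero outside
  \<open>carrier G\<close>. In this way \<open>\<rat>[G]\<close> is literally a subring of \<open>\<complex>[G]\<close>.
\<close>

definition group_algebra :: "complex set \<Rightarrow> ('g, 'z) monoid_scheme \<Rightarrow> ('g \<Rightarrow> complex) ring" where
  "group_algebra K G =
     \<lparr>carrier = {a. (\<forall>g \<in> carrier G. a g \<in> K) \<and> (\<forall>g. g \<notin> carrier G \<longrightarrow> a g = 0)},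
      mult = (\<lambda>a b x. if x \<in> carrier G
                then \<Sum>y \<in> carrier G. a y * b (inv\<^bsub>G\<^esub> y \<otimes>\<^bsub>G\<^esub> x) else 0),
      one = (\<lambda>x. if x = \<one>\<^bsub>G\<^esub> then 1 else 0),
      zero = (\<lambda>x. 0),
      add = (\<lambda>a b x. a x + b x)\<rparr>"

abbreviation rat_group_algebra :: "('g, 'z) monoid_scheme \<Rightarrow> ('g \<Rightarrow> complex) ring" where
  "rat_group_algebra G \<equiv> group_algebra \<rat> G"

abbreviation complex_group_algebra :: "('g, 'z) monoid_scheme \<Rightarrow> ('g \<Rightarrow> complex) ring" where
  "complex_group_algebra G \<equiv> group_algebra UNIV G"

definition group_elt :: "'g \<Rightarrow> 'g \<Rightarrow> complex" where
  "group_elt g = (\<lambda>x. if x = g then 1 else 0)"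

definition lin_comb :: "'i set \<Rightarrow> ('i \<Rightarrow> complex) \<Rightarrow> ('i \<Rightarrow> 'g \<Rightarrow> complex) \<Rightarrow> 'g \<Rightarrow> complex" where
  "lin_comb I c b = (\<lambda>x. \<Sum>i\<in>I. c i * b i x)"

definition rat_basis :: "'i set \<Rightarrow> ('i \<Rightarrow> 'g \<Rightarrow> complex) \<Rightarrow> ('g \<Rightarrow> complex) set \<Rightarrow> bool" where
  "rat_basis I b V \<longleftrightarrow>
     V = {lin_comb I (\<lambda>i. of_rat (c i)) b | c :: 'i \<Rightarrow> rat. True} \<and>
     (\<forall>c :: 'i \<Rightarrow> rat. lin_comb I (\<lambda>i. of_rat (c i)) b = (\<lambda>x. 0) \<longrightarrow> (\<forall>i\<in>I. c i = 0))"

definition left_ideal :: "'a set \<Rightarrow> ('a, 'z) ring_scheme \<Rightarrow> bool" where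
  "left_ideal I R \<longleftrightarrow>
     additive_subgroup I R \<and> (\<forall>r \<in> carrier R. \<forall>x\<in>I. r \<otimes>\<^bsub>R\<^esub> x \<in> I)"

definition minimal_left_ideal :: "'a set \<Rightarrow> ('a, 'z) ring_scheme \<Rightarrow> bool" where
  "minimal_left_ideal I R \<longleftrightarrow>
     left_ideal I R \<and> I \<noteq> {\<zero>\<^bsub>R\<^esub>} \<and>
     (\<forall>J. left_ideal J R \<and> J \<subseteq> I \<and> J \<noteq> {\<zero>\<^bsub>R\<^esub>} \<longrightarrow> J = I)"

definition GL :: "nat \<Rightarrow> 'k :: field mat monoid" where
  "GL n = units_of (ring_mat TYPE('k) n ())"

definition mat_trace :: "'k :: field mat \<Rightarrow> 'k" where
  "mat_trace A = (\<Sum>i < dim_row A. A $$ (i, i))"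

definition irreducible_rep :: "('g, 'z) monoid_scheme \<Rightarrow> nat \<Rightarrow> ('g \<Rightarrow> 'k :: field mat) \<Rightarrow> bool" where
  "irreducible_rep G n B \<longleftrightarrow>
     n > 0 \<and> B \<in> hom G (GL n) \<and>
     (\<forall>W. subspace class_ring W (module_vec TYPE('k) n) \<and>
          (\<forall>g \<in> carrier G. \<forall>x\<in>W. B g *\<^sub>v x \<in> W) \<longrightarrow>
          W = {0\<^sub>v n} \<or> W = carrier_vec n)"

text \<open>
  Absolute irreducibility is irreducibility over the algebraically closed field \<open>\<complex>\<close>.
\<close>

definition absolutely_irreducible_character ::
    "('g, 'z) monoid_scheme \<Rightarrow> ('g \<Rightarrow> complex) \<Rightarrow> bool" where
  "absolutely_irreducible_character G \<chi> \<longleftrightarrow>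
     (\<exists>n (B :: 'g \<Rightarrow> complex mat). irreducible_rep G n B \<and>
        (\<forall>g \<in> carrier G. \<chi> g = mat_trace (B g)))"

definition central_idem :: "('g, 'z) monoid_scheme \<Rightarrow> ('g \<Rightarrow> complex) \<Rightarrow> 'g \<Rightarrow> complex" where
  "central_idem G \<chi> =
     lin_comb (carrier G) (\<lambda>g. \<chi> \<one>\<^bsub>G\<^esub> / of_nat (Coset.order G) * cnj (\<chi> g)) group_elt"

text \<open>The ring \<open>\<rat>[G]c\<^sub>\<chi>\<close>, whose unit is \<open>c\<^sub>\<chi>\<close>.\<close>

definition block_algebra ::
    "('g, 'z) monoid_scheme \<Rightarrow> ('g \<Rightarrow> complex) \<Rightarrow> ('g \<Rightarrow> complex) ring" where
  "block_algebra G \<chi> = (rat_group_algebra G)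
     \<lparr>carrier := {a \<otimes>\<^bsub>rat_group_algebra G\<^esub> central_idem G \<chi> | a. a \<in> carrier (rat_group_algebra G)},
      one := central_idem G \<chi>\<rparr>"

definition LR :: "(complex \<Rightarrow> complex) monoid \<Rightarrow> complex \<Rightarrow>
    ((complex \<Rightarrow> complex) \<Rightarrow> complex) \<Rightarrow> ((complex \<Rightarrow> complex) \<Rightarrow> complex) set" where
  "LR G \<alpha> \<chi> =
     {M \<in> carrier (rat_group_algebra G).
        M = M \<otimes>\<^bsub>rat_group_algebra G\<^esub> central_idem G \<chi> \<and>
        M \<otimes>\<^bsub>complex_group_algebra G\<^esub>
          lin_comb (carrier G) (\<lambda>g. g \<alpha>) (\<lambda>g. group_elt (inv\<^bsub>G\<^esub> g))
        = \<zero>\<^bsub>complex_group_algebra G\<^esub>}"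

text \<open>The matrix \<open>\<Sum>g. g\<^sup>-\<^sup>1(\<alpha>) A(g)\<close>, summed entrywise.\<close>

definition conjugate_sum_mat :: "(complex \<Rightarrow> complex) monoid \<Rightarrow> complex \<Rightarrow> nat \<Rightarrow>
    ((complex \<Rightarrow> complex) \<Rightarrow> rat mat) \<Rightarrow> complex mat" where
  "conjugate_sum_mat G \<alpha> n A =
     mat n n (\<lambda>(i, j). \<Sum>g \<in> carrier G. (inv\<^bsub>G\<^esub> g) \<alpha> * of_rat (A g $$ (i, j)))"

end

theory Submission
  imports Defs "Jordan_Normal_Form.Schur_Decomposition"
begin

text \<open>
  Extend \<open>A\<close> linearly to a map \<open>\<rho>\<close> from \<open>\<complex>[G]\<close> to matrices. Comparing actions on the \<open>w\<^sub>k\<close> shows that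
  \<open>\<rho>(v\<^sub>i\<^sub>j)\<close> is the matrix unit \<open>E\<^sub>j\<^sub>i\<close>, so \<open>\<rho>(M) = (m\<^sub>i\<^sub>j)\<close>; with \<open>\<theta> = \<Sum>g. g\<^sup>-\<^sup>1(\<alpha>) g\<close> the matrix product of
  the theorem is \<open>\<rho>(M \<theta>)\<close>. The coefficient of \<open>x\<close> in \<open>a c\<^sub>\<chi>\<close> is a multiple of the trace of
  \<open>A(x\<^sup>-\<^sup>1) \<rho>(a)\<close>, so \<open>a c\<^sub>\<chi>\<close> depends only on \<open>\<rho>(a)\<close>. As \<open>c\<^sub>\<chi>\<close> is central, \<open>M \<theta> = (M \<theta>) c\<^sub>\<chi>\<close>, which
  therefore vanishes together with \<open>\<rho>(M \<theta>)\<close>.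

  For the first column, \<open>h \<in> G\<close> fixes the rational matrix \<open>m\<close> and maps \<open>\<rho>(\<theta>)\<close> to \<open>\<rho>(\<theta>) A(h)\<close>. If
  \<open>m \<rho>(\<theta>) e\<^sub>0 = 0\<close>, then \<open>m \<rho>(\<theta>)\<close> kills every \<open>A(h) e\<^sub>0\<close>, hence also \<open>\<rho>(v\<^sub>0\<^sub>j) e\<^sub>0 = e\<^sub>j\<close>.
\<close>

section \<open>Traces and invertible matrices\<close>

lemma mult_mat_index:
  assumes "P \<in> carrier_mat r m" "Q \<in> carrier_mat m c" "i < r" "j < c"
  shows "(P * Q) $$ (i, j) = (\<Sum>k<m. P $$ (i, k) * Q $$ (k, j))"
  using assms by (auto simp: scalar_prod_def atLeast0LessThan intro!: sum.cong)

lemma mat_trace_mult_comm: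
  assumes P: "P \<in> carrier_mat n m" and Q: "Q \<in> carrier_mat m n"
  shows "mat_trace (P * Q) = mat_trace (Q * P)"
proof -
  have "mat_trace (P * Q) = (\<Sum>i<n. \<Sum>k<m. P $$ (i, k) * Q $$ (k, i))"
    using P Q by (simp add: mat_trace_def mult_mat_index[OF P Q] del: index_mult_mat(1))
  also have "\<dots> = (\<Sum>k<m. \<Sum>i<n. Q $$ (k, i) * P $$ (i, k))"
    by (subst sum.swap) (simp add: mult.commute)
  also have "\<dots> = mat_trace (Q * P)"
    using P Q by (simp add: mat_trace_def mult_mat_index[OF Q P] del: index_mult_mat(1))
  finally show ?thesis .
qed

lemma mat_trace_similar:
  assumes "similar_mat P Q"
  shows "mat_trace P = mat_trace Q"
proof -
  obtain n S T where carrier: "Q \<in> carrier_mat n n" "S \<in> carrier_mat n n" "T \<in> carrier_mat n n"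
    and TS: "T * S = 1\<^sub>m n" and P: "P = S * Q * T"
    using similar_matD[OF assms] by auto
  have "mat_trace P = mat_trace (T * (S * Q))"
    unfolding P using carrier by (intro mat_trace_mult_comm) auto
  also have "T * (S * Q) = Q"
    using carrier TS by (simp flip: assoc_mult_mat)
  finally show ?thesis .
qed

lemma upper_triangular_mult:
  assumes carrier: "P \<in> carrier_mat n n" "Q \<in> carrier_mat n n"
    and tri: "upper_triangular P" "upper_triangular Q"
  shows "upper_triangular (P * Q)"
    and "i < n \<Longrightarrow> (P * Q) $$ (i, i) = P $$ (i, i) * Q $$ (i, i)"
proof -
  have zero: "P $$ (i, k) * Q $$ (k, j) = 0" if "i < n" "k < n" "j \<le> i" "k \<noteq> i \<or> j \<noteq> i" for i j k
  proof (cases "k < i")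
    case False
    then have "j < k" using that by linarith
    then show ?thesis using that carrier upper_triangularD[OF tri(2), of j k] by simp
  qed (use that carrier upper_triangularD[OF tri(1), of k i] in simp)
  then show "upper_triangular (P * Q)"
    using carrier by (auto simp: mult_mat_index[OF carrier] simp del: index_mult_mat(1))
  show "(P * Q) $$ (i, i) = P $$ (i, i) * Q $$ (i, i)" if "i < n"
    unfolding mult_mat_index[OF carrier that that]
    using that zero by (subst sum.remove[of _ i]) auto
qed

lemma upper_triangular_pow:
  assumes T: "T \<in> carrier_mat n n" and tri: "upper_triangular T"
  shows "upper_triangular (T ^\<^sub>m k)"
    and "i < n \<Longrightarrow> (T ^\<^sub>m k) $$ (i, i) = T $$ (i, i) ^ k"
proof -
  have "upper_triangular (T ^\<^sub>m k) \<and> (\<forall>i<n. (T ^\<^sub>m k) $$ (i, i) = T $$ (i, i) ^ k)"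
  proof (induction k)
    case (Suc k)
    then show ?case
      using upper_triangular_mult[OF pow_carrier_mat[OF T] T _ tri]
      by (simp del: index_mult_mat(1) power_Suc add: power_Suc2)
  qed (use T in simp)
  then show "upper_triangular (T ^\<^sub>m k)" "i < n \<Longrightarrow> (T ^\<^sub>m k) $$ (i, i) = T $$ (i, i) ^ k"
    by auto
qed

lemma cnj_of_rat: "cnj (of_rat q) = of_rat q"
  by (cases q) (simp add: of_rat_rat)

lemma cnj_root_of_unity:
  assumes "z ^ Suc k = 1"
  shows "cnj z = z ^ k"
proof -
  have "norm z ^ Suc k = 1 ^ Suc k"
    using arg_cong[OF assms, of norm] by (simp add: norm_power norm_mult)
  then have "norm z = 1"
    by (rule power_eq_imp_eq_base) auto
  then have "cnj z = 1 / z"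
    using divide_conv_cnj[of z 1] by simp
  also have "\<dots> = z ^ k"
    using assms by (cases "z = 0") (simp_all add: field_simps)
  finally show ?thesis .
qed

text \<open>The eigenvalues of a matrix of finite order are roots of unity, so inverting conjugates them.\<close>

lemma mat_trace_inverse_of_finite_order:
  fixes P Q :: "complex mat"
  assumes P: "P \<in> carrier_mat n n" and Q: "Q \<in> carrier_mat n n"
    and inverse: "P * Q = 1\<^sub>m n" and order: "P ^\<^sub>m Suc k = 1\<^sub>m n"
  shows "mat_trace Q = cnj (mat_trace P)"
proof -
  obtain T where T: "T \<in> carrier_mat n n" and tri: "upper_triangular T" and sim: "similar_mat P T"
    using char_poly_factorized[OF P] schur_decomposition_exists[OF P] by blast
  from sim obtain R S where wit: "similar_mat_wit P T R S"
    by (auto simp: similar_mat_def)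
  have trace_pow: "mat_trace (P ^\<^sub>m l) = (\<Sum>i<n. T $$ (i, i) ^ l)" for l
    using mat_trace_similar[of "P ^\<^sub>m l" "T ^\<^sub>m l"] similar_mat_wit_pow[OF wit] T
      upper_triangular_pow(2)[OF T tri]
    by (auto simp: similar_mat_def mat_trace_def)
  have "T ^\<^sub>m Suc k = S * 1\<^sub>m n * R"
    using similar_mat_wit_pow_id[OF similar_mat_wit_sym[OF wit]] order by metis
  also have "\<dots> = 1\<^sub>m n"
    using similar_mat_witD2[OF P wit] by simp
  finally have "T $$ (i, i) ^ Suc k = 1" if "i < n" for i
    using upper_triangular_pow(2)[OF T tri that, of "Suc k"] that by simp
  then have root: "cnj (T $$ (i, i)) = T $$ (i, i) ^ k" if "i < n" for i
    using that cnj_root_of_unity by blast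
  have "Q = P ^\<^sub>m k * P * Q"
    using order Q by simp
  also have "\<dots> = P ^\<^sub>m k"
    using P Q inverse by (simp add: assoc_mult_mat[of _ n n])
  finally have "mat_trace Q = (\<Sum>i<n. T $$ (i, i) ^ k)"
    by (simp add: trace_pow)
  also have "\<dots> = cnj (mat_trace (P ^\<^sub>m 1))"
    unfolding trace_pow by (simp add: root)
  finally show ?thesis
    using P by simp
qed

lemma carrier_GL:
  "P \<in> carrier (GL n) \<longleftrightarrow>
   P \<in> carrier_mat n n \<and> (\<exists>Q\<in>carrier_mat n n. P * Q = 1\<^sub>m n \<and> Q * P = 1\<^sub>m n)"
  by (auto simp: GL_def units_of_def Units_def ring_mat_simps)

lemma mult_GL: "P \<otimes>\<^bsub>GL n\<^esub> Q = P * Q"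
  by (simp add: GL_def units_of_def ring_mat_simps)

lemma one_GL: "\<one>\<^bsub>GL n\<^esub> = 1\<^sub>m n"
  by (simp add: GL_def units_of_def ring_mat_simps)

lemma group_GL: "group (GL n)"
  unfolding GL_def by (intro monoid.units_group ring.is_monoid ring_mat)

lemma (in field_hom) mat_hom_GL:
  assumes A: "A \<in> Group.hom G (GL n)"
  shows "(\<lambda>g. map_mat hom (A g)) \<in> Group.hom G (GL n)"
proof (rule Group.homI)
  have A_carrier: "A g \<in> carrier_mat n n" if "g \<in> carrier G" for g
    using A that by (auto simp: Group.hom_def Pi_def carrier_GL)
  show "map_mat hom (A g) \<in> carrier (GL n)" if g: "g \<in> carrier G" for g
  proof -
    from A g obtain Q where Q: "Q \<in> carrier_mat n n" "A g * Q = 1\<^sub>m n" "Q * A g = 1\<^sub>m n"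
      by (auto simp: Group.hom_def Pi_def carrier_GL)
    then have "map_mat hom (A g) * map_mat hom Q = 1\<^sub>m n" "map_mat hom Q * map_mat hom (A g) = 1\<^sub>m n"
      using A_carrier[OF g] by (simp_all add: mat_hom_one flip: mat_hom_mult)
    then show ?thesis
      using A_carrier[OF g] Q(1) by (auto simp: carrier_GL intro!: bexI[of _ "map_mat hom Q"])
  qed
  show "map_mat hom (A (g \<otimes>\<^bsub>G\<^esub> h)) = map_mat hom (A g) \<otimes>\<^bsub>GL n\<^esub> map_mat hom (A h)"
    if "g \<in> carrier G" "h \<in> carrier G" for g h
    using that by (simp add: Group.hom_mult[OF A] mult_GL mat_hom_mult[OF A_carrier A_carrier])
qed

section \<open>The group algebra and its blocks\<close>

lemma lin_comb_prod_swap: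
  "lin_comb (I \<times> J) (\<lambda>(i, j). c i j) (\<lambda>(i, j). b i j) =
   lin_comb (J \<times> I) (\<lambda>(j, i). c i j) (\<lambda>(j, i). b i j)"
  unfolding lin_comb_def
  by (intro ext sum.reindex_bij_witness[of _ prod.swap prod.swap]) auto

lemma rat_basis_coordinates_unique:
  assumes basis: "rat_basis I b V" and i: "i \<in> I"
    and eq: "lin_comb I (\<lambda>i. of_rat (c i)) b = lin_comb I (\<lambda>i. of_rat (d i)) b"
  shows "c i = d i"
proof -
  have "lin_comb I (\<lambda>i. of_rat (c i - d i)) b = (\<lambda>x. 0)"
    using eq by (simp add: lin_comb_def of_rat_diff left_diff_distrib sum_subtractf fun_eq_iff)
  then have "c i - d i = 0"
    using basis[unfolded rat_basis_def, THEN conjunct2, THEN spec, of "\<lambda>i. c i - d i"] i by simp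
  then show ?thesis by simp
qed

context group
begin

definition convolution :: "('a \<Rightarrow> complex) \<Rightarrow> ('a \<Rightarrow> complex) \<Rightarrow> 'a \<Rightarrow> complex" (infixl "\<star>" 70) where
  "a \<star> b = (\<lambda>x. if x \<in> carrier G then \<Sum>y\<in>carrier G. a y * b (inv y \<otimes> x) else 0)"

lemma mult_group_algebra: "a \<otimes>\<^bsub>group_algebra K G\<^esub> b = a \<star> b"
  by (simp add: group_algebra_def convolution_def fun_eq_iff)

lemma zero_group_algebra: "\<zero>\<^bsub>group_algebra K G\<^esub> = (\<lambda>x. 0)"
  by (simp add: group_algebra_def)

lemma carrier_rat_group_algebra:
  "a \<in> carrier (rat_group_algebra G) \<longleftrightarrow> (\<forall>g. a g \<in> \<rat>) \<and> (\<forall>g. g \<notin> carrier G \<longrightarrow> a g = 0)"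
  by (auto simp: group_algebra_def)

lemma sum_left_translate:
  assumes "y \<in> carrier G"
  shows "(\<Sum>x\<in>carrier G. f (y \<otimes> x)) = sum f (carrier G)"
  by (rule sum.reindex_bij_witness[of _ "\<lambda>x. inv y \<otimes> x" "\<lambda>x. y \<otimes> x"])
     (use assms in \<open>auto simp flip: m_assoc\<close>)

lemma sum_right_translate:
  assumes "y \<in> carrier G"
  shows "(\<Sum>x\<in>carrier G. f (x \<otimes> y)) = sum f (carrier G)"
  by (rule sum.reindex_bij_witness[of _ "\<lambda>x. x \<otimes> inv y" "\<lambda>x. x \<otimes> y"])
     (use assms in \<open>auto simp: m_assoc\<close>)

lemma convolution_assoc: "a \<star> b \<star> c = a \<star> (b \<star> c)"
proof
  fix x
  show "(a \<star> b \<star> c) x = (a \<star> (b \<star> c)) x"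
  proof (cases "x \<in> carrier G")
    case True
    have "(a \<star> b \<star> c) x =
        (\<Sum>y\<in>carrier G. \<Sum>z\<in>carrier G. a z * b (inv z \<otimes> y) * c (inv y \<otimes> x))"
      using True by (simp add: convolution_def sum_distrib_right)
    also have "\<dots> = (\<Sum>z\<in>carrier G. \<Sum>y\<in>carrier G. a z * b (inv z \<otimes> y) * c (inv y \<otimes> x))"
      by (rule sum.swap)
    also have "\<dots> = (\<Sum>z\<in>carrier G. \<Sum>u\<in>carrier G.
                     a z * b (inv z \<otimes> (z \<otimes> u)) * c (inv (z \<otimes> u) \<otimes> x))"
      by (intro sum.cong refl sum_left_translate[symmetric])
    also have "\<dots> = (\<Sum>z\<in>carrier G. \<Sum>u\<in>carrier G. a z * (b u * c (inv u \<otimes> (inv z \<otimes> x))))"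
      using True by (intro sum.cong refl) (simp add: inv_mult_group flip: m_assoc)
    also have "\<dots> = (a \<star> (b \<star> c)) x"
      using True by (simp add: convolution_def sum_distrib_left)
    finally show ?thesis .
  qed (simp add: convolution_def)
qed

lemma class_function_central:
  assumes "\<And>x y. x \<in> carrier G \<Longrightarrow> y \<in> carrier G \<Longrightarrow> c (x \<otimes> y) = c (y \<otimes> x)"
  shows "a \<star> c = c \<star> a"
proof
  fix x
  show "(a \<star> c) x = (c \<star> a) x"
  proof (cases "x \<in> carrier G")
    case True
    have "(\<Sum>y\<in>carrier G. a y * c (inv y \<otimes> x)) = (\<Sum>y\<in>carrier G. c y * a (inv y \<otimes> x))"
      by (rule sum.reindex_bij_witness[of _ "\<lambda>z. inv z \<otimes> x" "\<lambda>y. x \<otimes> inv y"])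
         (use True assms in \<open>auto simp: m_assoc inv_mult_group, auto simp flip: m_assoc\<close>)
    then show ?thesis using True by (simp add: convolution_def)
  qed (simp add: convolution_def)
qed

lemma lin_comb_convolution: "lin_comb I c b \<star> d = lin_comb I c (\<lambda>i. b i \<star> d)"
  unfolding convolution_def lin_comb_def
  by (auto simp: fun_eq_iff sum_distrib_right sum_distrib_left mult.assoc intro: sum.swap)

lemma convolution_eq_sum_translates:
  assumes "finite (carrier G)"
  shows "(a \<star> b) x = (\<Sum>g\<in>carrier G. a g * (group_elt g \<star> b) x)"
  using assms
  by (auto simp: convolution_def group_elt_def if_distrib[of "\<lambda>u. u * _"] cong: if_cong)

lemma lin_comb_group_elt_inv:
  assumes "finite (carrier G)"
  shows "lin_comb (carrier G) c (\<lambda>g. group_elt (inv g)) x =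
    (if x \<in> carrier G then c (inv x) else 0)"
proof -
  have "x = inv g \<longleftrightarrow> x \<in> carrier G \<and> g = inv x" if "g \<in> carrier G" for g
    using that by auto
  then have "lin_comb (carrier G) c (\<lambda>g. group_elt (inv g)) x =
      (\<Sum>g\<in>carrier G. if x \<in> carrier G \<and> g = inv x then c g else 0)"
    unfolding lin_comb_def group_elt_def by (intro sum.cong) auto
  then show ?thesis using assms by simp
qed

lemma central_idem_apply:
  assumes "finite (carrier G)"
  shows "central_idem G \<chi> x =
    (if x \<in> carrier G then \<chi> \<one> / of_nat (Coset.order G) * cnj (\<chi> x) else 0)"
  using assms
  by (simp add: central_idem_def lin_comb_def group_elt_def if_distrib[of "\<lambda>t. _ * t"] cong: if_cong)

lemma carrier_block_algebra:
  "carrier (block_algebra G \<chi>) = (\<lambda>a. a \<star> central_idem G \<chi>) ` carrier (rat_group_algebra G)"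
  by (auto simp: block_algebra_def mult_group_algebra)

lemma lin_comb_in_block:
  assumes "\<And>i. i \<in> I \<Longrightarrow> b i \<in> carrier (block_algebra G \<chi>)"
  shows "lin_comb I (\<lambda>i. of_rat (c i)) b \<in> carrier (block_algebra G \<chi>)"
proof -
  let ?e = "central_idem G \<chi>"
  obtain a where a: "\<And>i. i \<in> I \<Longrightarrow> a i \<in> carrier (rat_group_algebra G)"
    and b: "\<And>i. i \<in> I \<Longrightarrow> b i = a i \<star> ?e"
    using assms unfolding carrier_block_algebra image_iff by metis
  have "lin_comb I (\<lambda>i. of_rat (c i)) b = lin_comb I (\<lambda>i. of_rat (c i)) a \<star> ?e"
    unfolding lin_comb_convolution using b by (auto simp: lin_comb_def intro: sum.cong)
  moreover have "lin_comb I (\<lambda>i. of_rat (c i)) a \<in> carrier (rat_group_algebra G)"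
    using a by (auto simp: carrier_rat_group_algebra lin_comb_def intro!: Rats_sum Rats_mult sum.neutral)
  ultimately show ?thesis
    unfolding carrier_block_algebra by blast
qed

lemma block_rational:
  assumes "finite (carrier G)" "\<And>g. g \<in> carrier G \<Longrightarrow> \<chi> g \<in> \<rat>"
    and "x \<in> carrier (block_algebra G \<chi>)"
  shows "x g \<in> \<rat>"
proof -
  have "cnj (\<chi> h) \<in> \<rat>" if "h \<in> carrier G" for h
    using assms(2)[OF that] by (auto simp: cnj_of_rat elim!: Rats_cases)
  then have "central_idem G \<chi> h \<in> \<rat>" for h
    using assms(1,2) by (auto simp: central_idem_apply intro!: Rats_mult Rats_divide)
  then show ?thesis
    using assms(3) by (auto simp: carrier_block_algebra carrier_rat_group_algebra convolution_def
        intro!: Rats_sum Rats_mult)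
qed

end

section \<open>Linear extension of a matrix representation\<close>

locale complex_rep = group G for G (structure) +
  fixes n :: nat and B :: "'a \<Rightarrow> complex mat" and \<chi> :: "'a \<Rightarrow> complex"
  assumes finite_carrier: "finite (carrier G)"
    and rep_hom: "B \<in> hom G (GL n)"
    and character: "g \<in> carrier G \<Longrightarrow> \<chi> g = mat_trace (B g)"
begin

lemma rep_carrier: "g \<in> carrier G \<Longrightarrow> B g \<in> carrier_mat n n"
  using rep_hom by (auto simp: hom_def Pi_def carrier_GL)

lemma rep_mult: "g \<in> carrier G \<Longrightarrow> h \<in> carrier G \<Longrightarrow> B (g \<otimes> h) = B g * B h"
  using hom_mult[OF rep_hom] by (simp add: mult_GL)

lemma rep_one: "B \<one> = 1\<^sub>m n"
  using hom_one[OF rep_hom is_group group_GL] by (simp add: one_GL)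

lemma rep_pow: "g \<in> carrier G \<Longrightarrow> B (g [^] k) = B g ^\<^sub>m k"
proof (induction k)
  case (Suc k)
  then show ?case by (simp add: rep_mult)
qed (use rep_carrier carrier_matD(1) in \<open>fastforce simp: rep_one\<close>)

lemma character_inv:
  assumes g: "g \<in> carrier G"
  shows "\<chi> (inv g) = cnj (\<chi> g)"
proof -
  obtain k where "Coset.order G = Suc k"
    using finite_carrier order_gt_0_iff_finite gr0_implies_Suc by blast
  then have "B g ^\<^sub>m Suc k = 1\<^sub>m n"
    using g rep_pow[of g "Suc k"] pow_order_eq_1[of g] by (simp add: rep_one)
  moreover have "B g * B (inv g) = 1\<^sub>m n"
    using g by (simp add: rep_one flip: rep_mult)
  ultimately show ?thesis
    using g mat_trace_inverse_of_finite_order[OF rep_carrier rep_carrier, of g "inv g" k]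
    by (simp add: character)
qed

lemma character_comm:
  "g \<in> carrier G \<Longrightarrow> h \<in> carrier G \<Longrightarrow> \<chi> (g \<otimes> h) = \<chi> (h \<otimes> g)"
  by (simp add: character rep_mult mat_trace_mult_comm[OF rep_carrier rep_carrier])

definition lin_ext :: "('a \<Rightarrow> complex) \<Rightarrow> complex mat" where
  "lin_ext a = mat n n (\<lambda>(i, j). \<Sum>g\<in>carrier G. a g * B g $$ (i, j))"

lemma lin_ext_carrier [simp]: "lin_ext a \<in> carrier_mat n n"
  by (simp add: lin_ext_def)

lemma lin_ext_index:
  "i < n \<Longrightarrow> j < n \<Longrightarrow> lin_ext a $$ (i, j) = (\<Sum>g\<in>carrier G. a g * B g $$ (i, j))"
  by (simp add: lin_ext_def)

lemma lin_ext_zero: "lin_ext (\<lambda>x. 0) = 0\<^sub>m n n"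
  by (auto simp: lin_ext_def)

lemma lin_ext_lin_comb_index:
  assumes "i < n" "j < n"
  shows "lin_ext (lin_comb I c b) $$ (i, j) = (\<Sum>t\<in>I. c t * lin_ext (b t) $$ (i, j))"
  using assms
  by (simp add: lin_ext_index lin_comb_def sum_distrib_left sum_distrib_right mult.assoc)
     (rule sum.swap)

lemma mult_lin_ext_index:
  assumes P: "P \<in> carrier_mat r n" and ij: "i < r" "j < n"
  shows "(P * lin_ext a) $$ (i, j) = (\<Sum>g\<in>carrier G. a g * (P * B g) $$ (i, j))"
  using ij
  by (simp add: mult_mat_index[OF P lin_ext_carrier] mult_mat_index[OF P rep_carrier]
      lin_ext_index sum_distrib_left mult.left_commute del: index_mult_mat(1))
     (rule sum.swap)

lemma lin_ext_mult_index:
  assumes Q: "Q \<in> carrier_mat n c" and ij: "i < n" "j < c"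
  shows "(lin_ext a * Q) $$ (i, j) = (\<Sum>g\<in>carrier G. a g * (B g * Q) $$ (i, j))"
  using ij
  by (simp add: mult_mat_index[OF lin_ext_carrier Q] mult_mat_index[OF rep_carrier Q]
      lin_ext_index sum_distrib_left sum_distrib_right mult.assoc del: index_mult_mat(1))
     (rule sum.swap)

lemma mat_trace_mult_lin_ext:
  assumes P: "P \<in> carrier_mat n n"
  shows "mat_trace (P * lin_ext a) = (\<Sum>g\<in>carrier G. a g * mat_trace (P * B g))"
proof -
  have "mat_trace (P * lin_ext a) = (\<Sum>i<n. \<Sum>g\<in>carrier G. a g * (P * B g) $$ (i, i))"
    using P by (simp add: mat_trace_def mult_lin_ext_index[OF P] del: index_mult_mat(1))
  also have "\<dots> = (\<Sum>g\<in>carrier G. a g * mat_trace (P * B g))"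
    using P by (subst sum.swap) (simp add: mat_trace_def sum_distrib_left)
  finally show ?thesis .
qed

lemma lin_ext_convolution: "lin_ext (a \<star> b) = lin_ext a * lin_ext b"
proof (rule eq_matI)
  fix i j assume "i < dim_row (lin_ext a * lin_ext b)" "j < dim_col (lin_ext a * lin_ext b)"
  then have ij: "i < n" "j < n" by (simp_all add: lin_ext_def)
  have "lin_ext (a \<star> b) $$ (i, j) =
      (\<Sum>x\<in>carrier G. \<Sum>y\<in>carrier G. a y * b (inv y \<otimes> x) * B x $$ (i, j))"
    using ij by (simp add: lin_ext_index convolution_def sum_distrib_right)
  also have "\<dots> = (\<Sum>y\<in>carrier G. \<Sum>x\<in>carrier G. a y * b (inv y \<otimes> x) * B x $$ (i, j))"
    by (rule sum.swap)
  also have "\<dots> = (\<Sum>y\<in>carrier G. \<Sum>z\<in>carrier G.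
                     a y * b (inv y \<otimes> (y \<otimes> z)) * B (y \<otimes> z) $$ (i, j))"
    by (intro sum.cong refl sum_left_translate[symmetric])
  also have "\<dots> = (\<Sum>y\<in>carrier G. a y * (\<Sum>z\<in>carrier G. b z * (B y * B z) $$ (i, j)))"
    by (intro sum.cong refl) (simp add: rep_mult sum_distrib_left mult.assoc flip: m_assoc)
  also have "\<dots> = (\<Sum>y\<in>carrier G. a y * (B y * lin_ext b) $$ (i, j))"
    using ij by (intro sum.cong refl)
      (simp add: mult_lin_ext_index[OF rep_carrier] del: index_mult_mat(1))
  also have "\<dots> = (lin_ext a * lin_ext b) $$ (i, j)"
    by (rule lin_ext_mult_index[OF lin_ext_carrier ij, symmetric])
  finally show "lin_ext (a \<star> b) $$ (i, j) = (lin_ext a * lin_ext b) $$ (i, j)" .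
qed (simp_all add: lin_ext_def)

lemma lin_ext_rational:
  assumes "\<And>g. a g \<in> \<rat>" "\<And>g. g \<in> carrier G \<Longrightarrow> B g $$ (i, j) \<in> \<rat>" "i < n" "j < n"
  shows "lin_ext a $$ (i, j) \<in> \<rat>"
  using assms by (auto simp: lin_ext_index intro!: Rats_sum Rats_mult)

lemma convolution_central_idem:
  assumes x: "x \<in> carrier G"
  shows "(a \<star> central_idem G \<chi>) x =
    \<chi> \<one> / of_nat (Coset.order G) * mat_trace (B (inv x) * lin_ext a)"
proof -
  let ?r = "\<chi> \<one> / of_nat (Coset.order G)"
  have "cnj (\<chi> (inv y \<otimes> x)) = mat_trace (B (inv x) * B y)" if y: "y \<in> carrier G" for y
  proof -
    have "cnj (\<chi> (inv y \<otimes> x)) = \<chi> (inv (inv y \<otimes> x))"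
      using x y by (simp add: character_inv)
    also have "\<dots> = \<chi> (inv x \<otimes> y)"
      using x y by (simp add: inv_mult_group)
    finally show ?thesis
      using x y by (simp add: character rep_mult)
  qed
  then have "(a \<star> central_idem G \<chi>) x = ?r * (\<Sum>y\<in>carrier G. a y * mat_trace (B (inv x) * B y))"
    using x by (simp add: convolution_def central_idem_apply[OF finite_carrier] sum_distrib_left mult_ac)
  also have "\<dots> = ?r * mat_trace (B (inv x) * lin_ext a)"
    using x by (simp add: mat_trace_mult_lin_ext rep_carrier)
  finally show ?thesis .
qed

lemma convolution_central_idem_cong:
  assumes "lin_ext a = lin_ext b"
  shows "a \<star> central_idem G \<chi> = b \<star> central_idem G \<chi>"
proof
  fix x
  show "(a \<star> central_idem G \<chi>) x = (b \<star> central_idem G \<chi>) x"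
  proof (cases "x \<in> carrier G")
    case True
    then show ?thesis by (simp add: convolution_central_idem assms)
  qed (simp add: convolution_def)
qed

lemma central_idem_commute: "a \<star> central_idem G \<chi> = central_idem G \<chi> \<star> a"
  by (rule class_function_central) (simp add: central_idem_apply[OF finite_carrier] character_comm)

lemma convolution_eq_zero_iff:
  assumes a: "a = a \<star> central_idem G \<chi>"
  shows "a \<star> b = (\<lambda>x. 0) \<longleftrightarrow> lin_ext a * lin_ext b = 0\<^sub>m n n"
proof
  assume "a \<star> b = (\<lambda>x. 0)"
  then show "lin_ext a * lin_ext b = 0\<^sub>m n n"
    by (simp add: lin_ext_zero flip: lin_ext_convolution)
next
  assume "lin_ext a * lin_ext b = 0\<^sub>m n n"
  then have lin_ext_eq: "lin_ext (a \<star> b) = lin_ext (\<lambda>x. 0)"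
    by (simp add: lin_ext_zero lin_ext_convolution)
  have "a \<star> b = (a \<star> b) \<star> central_idem G \<chi>"
    by (subst a) (simp add: convolution_assoc central_idem_commute)
  also have "\<dots> = (\<lambda>x. 0) \<star> central_idem G \<chi>"
    by (rule convolution_central_idem_cong[OF lin_ext_eq])
  also have "\<dots> = (\<lambda>x. 0)"
    by (simp add: convolution_def fun_eq_iff)
  finally show "a \<star> b = (\<lambda>x. 0)" .
qed

lemma convolution_eq_lin_comb_lin_ext:
  assumes "\<And>g. g \<in> carrier G \<Longrightarrow> group_elt g \<star> w j = lin_comb {..<n} (\<lambda>i. B g $$ (i, j)) w"
    and "j < n"
  shows "a \<star> w j = lin_comb {..<n} (\<lambda>i. lin_ext a $$ (i, j)) w"
proof
  fix x
  have "(a \<star> w j) x = (\<Sum>g\<in>carrier G. \<Sum>i<n. a g * B g $$ (i, j) * w i x)"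
    unfolding convolution_eq_sum_translates[OF finite_carrier, of a]
    using assms by (simp add: lin_comb_def sum_distrib_left mult.assoc)
  also have "\<dots> = (\<Sum>i<n. \<Sum>g\<in>carrier G. a g * B g $$ (i, j) * w i x)"
    by (rule sum.swap)
  also have "\<dots> = lin_comb {..<n} (\<lambda>i. lin_ext a $$ (i, j)) w x"
    using assms(2) by (simp add: lin_comb_def lin_ext_index sum_distrib_right)
  finally show "(a \<star> w j) x = lin_comb {..<n} (\<lambda>i. lin_ext a $$ (i, j)) w x" .
qed

end

lemma complex_rep_of_rat:
  assumes "group G" "finite (carrier G)" and A: "A \<in> hom G (GL n)"
    and \<chi>: "\<forall>g\<in>carrier G. \<chi> g = of_rat (mat_trace (A g))"
  shows "complex_rep G n (\<lambda>g. map_mat of_rat (A g)) \<chi>"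
proof (intro complex_rep.intro complex_rep_axioms.intro)
  show "(\<lambda>g. map_mat of_rat (A g)) \<in> hom G (GL n)"
    by (rule of_rat_hom.mat_hom_GL[OF A])
  fix g assume "g \<in> carrier G"
  then show "\<chi> g = mat_trace (map_mat of_rat (A g))"
    using A \<chi> by (auto simp: hom_def Pi_def carrier_GL mat_trace_def of_rat_sum)
qed fact+

section \<open>Matrix units of the block\<close>

definition matrix_unit :: "nat \<Rightarrow> nat \<Rightarrow> nat \<Rightarrow> 'k :: zero_neq_one mat" where
  "matrix_unit n i j = mat n n (\<lambda>p. if p = (i, j) then 1 else 0)"

lemma matrix_unit_carrier [simp]: "matrix_unit n i j \<in> carrier_mat n n"
  by (simp add: matrix_unit_def)

lemma matrix_unit_index:
  "k < n \<Longrightarrow> l < n \<Longrightarrow> matrix_unit n i j $$ (k, l) = (if k = i \<and> l = j then 1 else 0)"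
  by (simp add: matrix_unit_def)

lemma mult_matrix_unit_index:
  fixes P :: "'k :: semiring_1 mat"
  assumes "P \<in> carrier_mat r n" "i < r" "j < n" "k < n"
  shows "(P * matrix_unit n j k) $$ (i, k) = P $$ (i, j)"
  using assms
  by (simp add: mult_mat_index[OF assms(1) matrix_unit_carrier] matrix_unit_index
      if_distrib[of "\<lambda>t. _ * t"] del: index_mult_mat(1) cong: if_cong)

locale block_matrix_units =
  complex_rep G n "\<lambda>g. map_mat of_rat (A g)" \<chi>
  for G (structure) and n and A :: "'a \<Rightarrow> rat mat" and \<chi> +
  fixes \<mm> :: "('a \<Rightarrow> complex) set"
    and w :: "nat \<Rightarrow> 'a \<Rightarrow> complex" and v :: "nat \<Rightarrow> nat \<Rightarrow> 'a \<Rightarrow> complex"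
  assumes w_basis: "rat_basis {..<n} w \<mm>"
    and group_elt_w: "\<forall>g \<in> carrier G. \<forall>j<n.
      group_elt g \<otimes>\<^bsub>rat_group_algebra G\<^esub> w j = lin_comb {..<n} (\<lambda>i. of_rat (A g $$ (i, j))) w"
    and v_block: "\<forall>i<n. \<forall>j<n. v i j \<in> carrier (block_algebra G \<chi>)"
    and v_w: "\<forall>i<n. \<forall>j<n. \<forall>k<n.
      v i j \<otimes>\<^bsub>rat_group_algebra G\<^esub> w k = (if i = k then w j else \<zero>\<^bsub>rat_group_algebra G\<^esub>)"
begin

lemma rep_index:
  assumes "g \<in> carrier G" "i < n" "j < n"
  shows "map_mat of_rat (A g) $$ (i, j) = (of_rat (A g $$ (i, j)) :: complex)"
  using rep_carrier[OF assms(1)] assms(2,3) by simp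

lemma lin_ext_block_rational:
  assumes x: "x \<in> carrier (block_algebra G \<chi>)" and ij: "i < n" "j < n"
  shows "lin_ext x $$ (i, j) \<in> \<rat>"
proof (rule lin_ext_rational[OF _ _ ij])
  have "\<chi> g \<in> \<rat>" if "g \<in> carrier G" for g
    using rep_carrier[OF that] by (auto simp: character[OF that] mat_trace_def intro!: Rats_sum)
  then show "x g \<in> \<rat>" for g
    by (rule block_rational[OF finite_carrier _ x])
  show "map_mat of_rat (A g) $$ (i, j) \<in> (\<rat> :: complex set)" if "g \<in> carrier G" for g
    by (simp add: rep_index[OF that ij])
qed

lemma lin_ext_v:
  assumes ij: "i < n" "j < n"
  shows "lin_ext (v i j) = matrix_unit n j i"
proof (rule eq_matI)
  fix l k assume "l < dim_row (matrix_unit n j i :: complex mat)"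
    "k < dim_col (matrix_unit n j i :: complex mat)"
  then have lk: "l < n" "k < n" by (simp_all add: matrix_unit_def)
  have "\<forall>l<n. \<exists>q. lin_ext (v i j) $$ (l, k) = of_rat q"
    using lin_ext_block_rational v_block ij lk(2) by (metis Rats_cases)
  then obtain q where q: "\<And>l. l < n \<Longrightarrow> lin_ext (v i j) $$ (l, k) = of_rat (q l)"
    by metis
  have "lin_comb {..<n} (\<lambda>l. of_rat (q l)) w = v i j \<star> w k"
    using convolution_eq_lin_comb_lin_ext[of w k "v i j"] group_elt_w lk(2) q
    by (simp add: mult_group_algebra rep_index lin_comb_def)
  also have "\<dots> = (if i = k then w j else (\<lambda>x. 0))"
    using v_w ij lk(2) by (simp add: mult_group_algebra zero_group_algebra)
  also have "\<dots> = lin_comb {..<n} (\<lambda>l. of_rat (matrix_unit n j i $$ (l, k))) w"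
    using ij lk(2) by (auto simp: fun_eq_iff lin_comb_def matrix_unit_index if_distrib[of of_rat]
        if_distrib[of "\<lambda>t. t * _"] cong: if_cong)
  finally have "q l = matrix_unit n j i $$ (l, k)"
    using rat_basis_coordinates_unique[OF w_basis, of l q "\<lambda>l. matrix_unit n j i $$ (l, k)"] lk(1)
    by simp
  then show "lin_ext (v i j) $$ (l, k) = matrix_unit n j i $$ (l, k)"
    using q lk by (simp add: matrix_unit_index)
qed (simp_all add: lin_ext_def matrix_unit_def)

lemma lin_ext_lin_comb_v:
  "lin_ext (lin_comb ({..<n} \<times> {..<n}) c (\<lambda>(i, j). v i j)) = mat n n (\<lambda>(j, i). c (i, j))"
proof (rule eq_matI)
  fix j i assume "j < dim_row (mat n n (\<lambda>(j, i). c (i, j)))" "i < dim_col (mat n n (\<lambda>(j, i). c (i, j)))"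
  then have ji: "j < n" "i < n" by simp_all
  have "lin_ext (lin_comb ({..<n} \<times> {..<n}) c (\<lambda>(i, j). v i j)) $$ (j, i) =
      (\<Sum>t\<in>{..<n} \<times> {..<n}. if t = (i, j) then c t else 0)"
    unfolding lin_ext_lin_comb_index[OF ji]
    using ji by (intro sum.cong refl) (auto simp: lin_ext_v matrix_unit_index split: if_splits)
  then show "lin_ext (lin_comb ({..<n} \<times> {..<n}) c (\<lambda>(i, j). v i j)) $$ (j, i) =
      mat n n (\<lambda>(j, i). c (i, j)) $$ (j, i)"
    using ji by simp
qed (simp_all add: lin_ext_def)

lemma lin_ext_coordinates:
  assumes "m \<in> carrier_mat n n"
  shows "lin_ext (lin_comb ({..<n} \<times> {..<n}) (\<lambda>(k, l). of_rat (m $$ (k, l))) (\<lambda>(k, l). v l k)) =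
    map_mat of_rat m"
  using assms by (subst lin_comb_prod_swap) (auto simp: lin_ext_lin_comb_v)

text \<open>
  No orthogonality relation for characters is needed: the block contains \<open>\<Sum>i. v\<^sub>i\<^sub>i\<close>, which is mapped
  to the identity.
\<close>

lemma lin_ext_central_idem_right_invertible:
  obtains Q where "Q \<in> carrier_mat n n" "lin_ext (central_idem G \<chi>) * Q = 1\<^sub>m n"
proof -
  let ?e = "central_idem G \<chi>"
  let ?u = "lin_comb ({..<n} \<times> {..<n}) (\<lambda>(i, j). of_rat (of_bool (i = j))) (\<lambda>(i, j). v i j)"
  have "?u \<in> carrier (block_algebra G \<chi>)"
    using lin_comb_in_block[of "{..<n} \<times> {..<n}" "\<lambda>(i, j). v i j" \<chi> "\<lambda>(i, j). of_bool (i = j)"] v_block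
    by (auto simp: case_prod_unfold)
  then obtain a where "?u = a \<star> ?e"
    by (auto simp: carrier_block_algebra)
  moreover have "lin_ext ?u = 1\<^sub>m n"
    by (auto simp: lin_ext_lin_comb_v)
  ultimately have "lin_ext a * lin_ext ?e = 1\<^sub>m n"
    by (simp add: lin_ext_convolution)
  then have "lin_ext ?e * lin_ext a = 1\<^sub>m n"
    by (rule mat_mult_left_right_inverse[OF lin_ext_carrier lin_ext_carrier])
  then show ?thesis
    using that lin_ext_carrier by blast
qed

lemma inj_on_lin_ext_block: "inj_on lin_ext (carrier (block_algebra G \<chi>))"
proof (rule inj_onI)
  let ?e = "central_idem G \<chi>"
  fix x y
  assume "x \<in> carrier (block_algebra G \<chi>)" "y \<in> carrier (block_algebra G \<chi>)"
  then obtain a b where x: "x = a \<star> ?e" and y: "y = b \<star> ?e"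
    by (auto simp: carrier_block_algebra)
  obtain Q where Q: "Q \<in> carrier_mat n n" "lin_ext ?e * Q = 1\<^sub>m n"
    by (rule lin_ext_central_idem_right_invertible)
  have cancel: "lin_ext c = lin_ext (c \<star> ?e) * Q" for c
    using Q by (simp add: lin_ext_convolution right_mult_one_mat[OF lin_ext_carrier]
        assoc_mult_mat[OF lin_ext_carrier lin_ext_carrier])
  assume "lin_ext x = lin_ext y"
  then have "lin_ext a = lin_ext b"
    using cancel[of a] cancel[of b] by (simp add: x y)
  then show "x = y"
    unfolding x y by (rule convolution_central_idem_cong)
qed

lemma block_basis: "rat_basis ({..<n} \<times> {..<n}) (\<lambda>(i, j). v i j) (carrier (block_algebra G \<chi>))"
proof -
  let ?I = "{..<n} \<times> {..<n}"
  have span: "lin_comb ?I (\<lambda>t. of_rat (c t)) (\<lambda>(i, j). v i j) \<in> carrier (block_algebra G \<chi>)" for c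
    using v_block by (intro lin_comb_in_block) auto
  have "\<exists>c. x = lin_comb ?I (\<lambda>t. of_rat (c t)) (\<lambda>(i, j). v i j)"
    if x: "x \<in> carrier (block_algebra G \<chi>)" for x
  proof -
    have "\<forall>i<n. \<forall>j<n. \<exists>q. lin_ext x $$ (j, i) = of_rat q"
      using lin_ext_block_rational[OF x] by (metis Rats_cases)
    then obtain c where c: "\<And>i j. i < n \<Longrightarrow> j < n \<Longrightarrow> lin_ext x $$ (j, i) = of_rat (c (i, j))"
      by (metis case_prod_conv)
    have "lin_ext x = lin_ext (lin_comb ?I (\<lambda>t. of_rat (c t)) (\<lambda>(i, j). v i j))"
      unfolding lin_ext_lin_comb_v by (rule eq_matI) (simp_all add: c, simp_all add: lin_ext_def)
    then show ?thesis
      using inj_onD[OF inj_on_lin_ext_block _ x span] by blast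
  qed
  moreover have "c t = 0"
    if zero: "lin_comb ?I (\<lambda>t. of_rat (c t)) (\<lambda>(i, j). v i j) = (\<lambda>x. 0)" and t: "t \<in> ?I" for c t
  proof -
    have "mat n n (\<lambda>(j, i). of_rat (c (i, j))) = (0\<^sub>m n n :: complex mat)"
      using lin_ext_lin_comb_v[of "\<lambda>t. of_rat (c t)"] by (simp add: zero lin_ext_zero)
    from arg_cong[OF this, of "\<lambda>P. P $$ (snd t, fst t)"] show "c t = 0"
      using t by auto
  qed
  ultimately show ?thesis
    using span unfolding rat_basis_def by blast
qed

end

section \<open>Galois groups of subfields of the complex numbers\<close>

locale rat_subalgebra =
  fixes K :: "complex set"
  assumes add_closed: "x \<in> K \<Longrightarrow> y \<in> K \<Longrightarrow> x + y \<in> K"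
    and mult_closed: "x \<in> K \<Longrightarrow> y \<in> K \<Longrightarrow> x * y \<in> K"
    and rat_closed: "q \<in> \<rat> \<Longrightarrow> q \<in> K"
begin

lemma sum_closed: "(\<And>i. i \<in> I \<Longrightarrow> f i \<in> K) \<Longrightarrow> sum f I \<in> K"
  by (induction I rule: infinite_finite_induct) (auto intro: add_closed rat_closed)

lemma poly_closed: "(\<And>i. coeff p i \<in> \<rat>) \<Longrightarrow> x \<in> K \<Longrightarrow> poly p x \<in> K"
proof (induction p)
  case (pCons a p)
  then have "a \<in> \<rat>" "\<And>i. coeff p i \<in> \<rat>"
    using pCons.prems(1)[of 0] pCons.prems(1)[of "Suc _"] by auto
  then show ?case
    using pCons by (auto intro: add_closed mult_closed rat_closed)
qed (simp add: rat_closed)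

lemma aut_closed: "s \<in> field_auts K \<Longrightarrow> x \<in> K \<Longrightarrow> s x \<in> K"
  using Bij_imp_funcset by (fastforce simp: field_auts_def)

lemma aut_add: "s \<in> field_auts K \<Longrightarrow> x \<in> K \<Longrightarrow> y \<in> K \<Longrightarrow> s (x + y) = s x + s y"
  by (simp add: field_auts_def)

lemma aut_mult: "s \<in> field_auts K \<Longrightarrow> x \<in> K \<Longrightarrow> y \<in> K \<Longrightarrow> s (x * y) = s x * s y"
  by (simp add: field_auts_def)

lemma aut_rat: "s \<in> field_auts K \<Longrightarrow> q \<in> \<rat> \<Longrightarrow> s q = q"
  by (simp add: field_auts_def)

lemma aut_uminus:
  assumes "s \<in> field_auts K" "x \<in> K"
  shows "s (- x) = - s x"
proof -
  have "s (- 1 * x) = - 1 * s x"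
    using assms by (simp only: aut_mult aut_rat rat_closed Rats_minus_iff Rats_1)
  then show ?thesis by simp
qed

lemma aut_inverse:
  assumes s: "s \<in> field_auts K" and x: "x \<in> K" "inverse x \<in> K" "x \<noteq> 0"
  shows "s (inverse x) = inverse (s x)"
proof -
  have "s x * s (inverse x) = s (x * inverse x)"
    using s x by (simp only: aut_mult)
  also have "\<dots> = 1"
    using s x by (simp add: aut_rat)
  finally show ?thesis
    by (rule inverse_unique[symmetric])
qed

lemma aut_sum:
  assumes "s \<in> field_auts K" "\<And>i. i \<in> I \<Longrightarrow> f i \<in> K"
  shows "s (sum f I) = (\<Sum>i\<in>I. s (f i))"
  using assms(2)
  by (induction I rule: infinite_finite_induct)
     (auto simp: assms(1) aut_add aut_rat sum_closed)

lemma aut_poly: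
  assumes s: "s \<in> field_auts K" and x: "x \<in> K"
  shows "(\<And>i. coeff p i \<in> \<rat>) \<Longrightarrow> s (poly p x) = poly p (s x)"
proof (induction p)
  case (pCons a p)
  then have "a \<in> \<rat>" "\<And>i. coeff p i \<in> \<rat>"
    using pCons.prems[of 0] pCons.prems[of "Suc _"] by auto
  then show ?case
    using pCons.IH s x by (simp add: aut_add aut_mult aut_rat mult_closed poly_closed rat_closed)
qed (simp add: aut_rat s)

lemma field_auts_subgroup: "subgroup (field_auts K) (BijGroup K)"
proof
  show "field_auts K \<subseteq> carrier (BijGroup K)"
    by (auto simp: field_auts_def BijGroup_def)
  show "\<one>\<^bsub>BijGroup K\<^esub> \<in> field_auts K"
    by (auto simp: field_auts_def BijGroup_def id_Bij add_closed mult_closed rat_closed)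
  fix s assume s: "s \<in> field_auts K"
  then have Bij: "s \<in> Bij K" by (simp add: field_auts_def)
  have "inv_into K s (x + y) = inv_into K s x + inv_into K s y"
    "inv_into K s (x * y) = inv_into K s x * inv_into K s y" if "x \<in> K" "y \<in> K" for x y
    using s that by (auto simp: field_auts_def add_closed mult_closed intro!: Bij_inv_into_lemma[of K s])
  moreover have "inv_into K s q = q" if "q \<in> \<rat>" for q
    using s Bij that by (intro inv_into_f_eq) (auto simp: aut_rat rat_closed Bij_def bij_betw_def)
  ultimately show "inv\<^bsub>BijGroup K\<^esub> s \<in> field_auts K"
    using Bij restrict_inv_into_Bij[OF Bij]
    by (auto simp: inv_BijGroup field_auts_def add_closed mult_closed rat_closed)
  fix t assume t: "t \<in> field_auts K"
  then have "compose K s t \<in> Bij K"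
    using Bij by (simp add: field_auts_def compose_Bij)
  then show "s \<otimes>\<^bsub>BijGroup K\<^esub> t \<in> field_auts K"
    using s t aut_closed[OF t] by (auto simp: field_auts_def BijGroup_def compose_def
        add_closed mult_closed rat_closed)
qed

lemma carrier_galois_group: "carrier (galois_group K) = field_auts K"
  by (simp add: galois_group_def)

lemma group_galois_group: "group (galois_group K)"
  unfolding galois_group_def
  by (rule subgroup.subgroup_is_group[OF field_auts_subgroup group_BijGroup])

lemma galois_group_mult_apply:
  assumes "s \<in> field_auts K" "t \<in> field_auts K" "x \<in> K"
  shows "(s \<otimes>\<^bsub>galois_group K\<^esub> t) x = s (t x)"
  using assms by (simp add: galois_group_def field_auts_def BijGroup_def compose_def)

end

lemma rat_subalgebra_adjoin_rat: "rat_subalgebra (adjoin_rat \<alpha>)"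
proof
  fix x y assume "x \<in> adjoin_rat \<alpha>" "y \<in> adjoin_rat \<alpha>"
  then show "x + y \<in> adjoin_rat \<alpha>" "x * y \<in> adjoin_rat \<alpha>"
    using generate_field.eng_add[of x class_ring _ y] generate_field.eng_mult[of x class_ring _ y]
    by (auto simp: adjoin_rat_def)
qed (auto simp: adjoin_rat_def intro: generate_field.incl)

lemma in_adjoin_rat: "\<alpha> \<in> adjoin_rat \<alpha>"
  by (auto simp: adjoin_rat_def intro: generate_field.incl)

lemma field_auts_adjoin_rat_eqI:
  assumes s: "s \<in> field_auts (adjoin_rat \<alpha>)" and t: "t \<in> field_auts (adjoin_rat \<alpha>)"
    and eq: "s \<alpha> = t \<alpha>"
  shows "s = t"
proof -
  interpret rat_subalgebra "adjoin_rat \<alpha>" by (rule rat_subalgebra_adjoin_rat)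
  have "s x = t x" if "x \<in> adjoin_rat \<alpha>" for x
    using that unfolding adjoin_rat_def
  proof (induction rule: generate_field.induct)
    case (a_inv x)
    then have "x \<in> adjoin_rat \<alpha>" by (simp add: adjoin_rat_def)
    then show ?case
      using a_inv.IH s t by (simp add: aut_uminus class_ring_simps)
  next
    case (m_inv x)
    then have "x \<in> adjoin_rat \<alpha>" "inverse x \<in> adjoin_rat \<alpha>" "x \<noteq> 0"
      using generate_field.m_inv[of x class_ring] by (auto simp: adjoin_rat_def class_ring_simps)
    then show ?case
      using m_inv.IH s t by (simp add: aut_inverse class_ring_simps del: inverse_eq_iff_eq)
  qed (use s t eq in \<open>auto simp: aut_rat aut_add aut_mult simp flip: adjoin_rat_def\<close>)
  then show ?thesis
    using s t by (intro extensionalityI[of s "adjoin_rat \<alpha>" t])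
      (auto simp: field_auts_def Bij_imp_extensional)
qed

lemma finite_field_auts_adjoin_rat:
  assumes "algebraic \<alpha>"
  shows "finite (field_auts (adjoin_rat \<alpha>))"
proof -
  interpret rat_subalgebra "adjoin_rat \<alpha>" by (rule rat_subalgebra_adjoin_rat)
  obtain p where p: "\<And>i. coeff p i \<in> \<rat>" "p \<noteq> 0" "poly p \<alpha> = 0"
    using assms unfolding algebraic_altdef by blast
  have "poly p (s \<alpha>) = 0" if "s \<in> field_auts (adjoin_rat \<alpha>)" for s
    using aut_poly[OF that in_adjoin_rat p(1)] p(3) aut_rat[OF that, of 0] by simp
  then have "(\<lambda>s. s \<alpha>) ` field_auts (adjoin_rat \<alpha>) \<subseteq> {x. poly p x = 0}"
    by auto
  then have "finite ((\<lambda>s. s \<alpha>) ` field_auts (adjoin_rat \<alpha>))"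
    using poly_roots_finite[OF p(2)] finite_subset by blast
  moreover have "inj_on (\<lambda>s. s \<alpha>) (field_auts (adjoin_rat \<alpha>))"
    by (intro inj_onI field_auts_adjoin_rat_eqI)
  ultimately show ?thesis
    by (rule finite_imageD)
qed

section \<open>The conjugate sum matrix\<close>

locale galois_block =
  rat_subalgebra K + block_matrix_units G n A \<chi> \<mm> w v
  for K and G :: "(complex \<Rightarrow> complex) monoid" (structure) and n A \<chi> \<mm> w v +
  fixes \<alpha> :: complex
  assumes G_eq: "G = galois_group K" and \<alpha>_mem: "\<alpha> \<in> K"
begin

lemma carrier_G: "carrier G = field_auts K"
  by (simp add: G_eq carrier_galois_group)

lemma mult_apply: "g \<in> carrier G \<Longrightarrow> h \<in> carrier G \<Longrightarrow> x \<in> K \<Longrightarrow> (g \<otimes> h) x = g (h x)"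
  using galois_group_mult_apply by (simp add: G_eq carrier_galois_group)

lemma inv_\<alpha>_mem: "g \<in> carrier G \<Longrightarrow> (inv g) \<alpha> \<in> K"
  using inv_closed[of g] by (simp add: aut_closed carrier_G \<alpha>_mem)

abbreviation conjugate_sum :: "complex mat" where
  "conjugate_sum \<equiv> conjugate_sum_mat G \<alpha> n A"

lemma conjugate_sum_eq_lin_ext: "conjugate_sum = lin_ext (\<lambda>g. (inv g) \<alpha>)"
  by (rule eq_matI) (simp_all add: conjugate_sum_mat_def lin_ext_def rep_index)

lemma conjugate_sum_carrier [simp]: "conjugate_sum \<in> carrier_mat n n"
  by (simp add: conjugate_sum_eq_lin_ext)

lemma conjugate_sum_index_mem: "i < n \<Longrightarrow> j < n \<Longrightarrow> conjugate_sum $$ (i, j) \<in> K"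
  by (auto simp: conjugate_sum_mat_def intro!: sum_closed mult_closed inv_\<alpha>_mem intro: rat_closed)

lemma aut_conjugate_sum:
  assumes h: "h \<in> carrier G" and ij: "i < n" "j < n"
  shows "h (conjugate_sum $$ (i, j)) = (conjugate_sum * map_mat of_rat (A h)) $$ (i, j)"
proof -
  have "(conjugate_sum * map_mat of_rat (A h)) $$ (i, j) =
      (\<Sum>g\<in>carrier G. (inv g) \<alpha> * of_rat (A (g \<otimes> h) $$ (i, j)))"
    unfolding conjugate_sum_eq_lin_ext lin_ext_mult_index[OF rep_carrier[OF h] ij]
    using h ij by (simp add: rep_index flip: rep_mult del: index_mult_mat(1))
  also have "\<dots> = (\<Sum>g\<in>carrier G. h ((inv (g \<otimes> h)) \<alpha>) * of_rat (A (g \<otimes> h) $$ (i, j)))"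
  proof (intro sum.cong refl arg_cong2[of _ _ _ _ "(*)"])
    fix g assume g: "g \<in> carrier G"
    have "(inv g) \<alpha> = (h \<otimes> inv (g \<otimes> h)) \<alpha>"
      using g h by (simp add: inv_mult_group flip: m_assoc)
    also have "\<dots> = h ((inv (g \<otimes> h)) \<alpha>)"
      using g h by (simp add: mult_apply \<alpha>_mem)
    finally show "(inv g) \<alpha> = h ((inv (g \<otimes> h)) \<alpha>)" .
  qed
  also have "\<dots> = (\<Sum>g\<in>carrier G. h ((inv g) \<alpha>) * of_rat (A g $$ (i, j)))"
    by (rule sum_right_translate[OF h])
  also have "\<dots> = h (conjugate_sum $$ (i, j))"
    using h ij by (simp add: conjugate_sum_mat_def carrier_G aut_sum aut_mult aut_rat mult_closed
        inv_\<alpha>_mem[unfolded carrier_G] rat_closed)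
  finally show ?thesis by simp
qed

lemma aut_rat_mult_conjugate_sum:
  assumes h: "h \<in> carrier G" and m: "m \<in> carrier_mat r n" and ij: "i < r" "j < n"
  shows "h ((map_mat of_rat m * conjugate_sum) $$ (i, j)) =
    (map_mat of_rat m * conjugate_sum * map_mat of_rat (A h)) $$ (i, j)"
proof -
  let ?m = "map_mat of_rat m :: complex mat"
  have m': "?m \<in> carrier_mat r n" using m by simp
  have "(?m * conjugate_sum) $$ (i, j) = (\<Sum>k<n. of_rat (m $$ (i, k)) * conjugate_sum $$ (k, j))"
    unfolding mult_mat_index[OF m' conjugate_sum_carrier ij] using m ij by simp
  also have "h \<dots> = (\<Sum>k<n. of_rat (m $$ (i, k)) * h (conjugate_sum $$ (k, j)))"
    using h[unfolded carrier_G] ij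
    by (subst aut_sum) (auto simp: aut_mult aut_rat conjugate_sum_index_mem rat_closed intro!: mult_closed)
  also have "\<dots> = (?m * (conjugate_sum * map_mat of_rat (A h))) $$ (i, j)"
    unfolding mult_mat_index[OF m' mult_carrier_mat[OF conjugate_sum_carrier rep_carrier[OF h]] ij]
    using m ij by (simp add: aut_conjugate_sum[OF h] del: index_mult_mat(1))
  finally show ?thesis
    by (simp add: assoc_mult_mat[OF m' conjugate_sum_carrier rep_carrier[OF h]])
qed

lemma rat_mult_conjugate_sum_row_eq_0:
  assumes m: "m \<in> carrier_mat r n" and ij: "i < r" "j < n"
    and zero: "(map_mat of_rat m * conjugate_sum) $$ (i, 0) = 0"
  shows "(map_mat of_rat m * conjugate_sum) $$ (i, j) = 0"
proof -
  let ?P = "map_mat of_rat m * conjugate_sum"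
  have P: "?P \<in> carrier_mat r n"
    using m conjugate_sum_carrier by auto
  have n: "0 < n" using ij(2) by simp
  have "(?P * map_mat of_rat (A h)) $$ (i, 0) = 0" if h: "h \<in> carrier G" for h
    using aut_rat_mult_conjugate_sum[OF h m ij(1) n] zero h by (simp add: carrier_G aut_rat)
  then have "(?P * lin_ext (v 0 j)) $$ (i, 0) = 0"
    by (simp add: mult_lin_ext_index[OF P ij(1) n] del: index_mult_mat(1))
  then show ?thesis
    using mult_matrix_unit_index[OF P ij n] n ij(2) by (simp add: lin_ext_v del: index_mult_mat(1))
qed

lemma rat_mult_conjugate_sum_eq_0_iff:
  assumes m: "m \<in> carrier_mat r n"
  shows "map_mat of_rat m * conjugate_sum = 0\<^sub>m r n \<longleftrightarrow>
      map_mat of_rat m *\<^sub>v col conjugate_sum 0 = 0\<^sub>v r"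
    (is "?P = _ \<longleftrightarrow> ?u = _")
proof -
  have u: "?u $ i = (if n = 0 then 0 else ?P $$ (i, 0))" if "i < r" for i
    using that m carrier_matD[OF conjugate_sum_carrier] by (simp add: scalar_prod_def)
  have "?P = 0\<^sub>m r n \<longleftrightarrow> (\<forall>i<r. \<forall>j<n. ?P $$ (i, j) = 0)"
    using m carrier_matD[OF conjugate_sum_carrier] by (simp add: mat_eq_iff del: index_mult_mat(1))
  also have "\<dots> \<longleftrightarrow> (\<forall>i<r. n = 0 \<or> ?P $$ (i, 0) = 0)"
    using rat_mult_conjugate_sum_row_eq_0[OF m] by blast
  also have "\<dots> \<longleftrightarrow> ?u = 0\<^sub>v r"
    using m u by (auto simp: vec_eq_iff simp del: index_mult_mat_vec)
  finally show ?thesis .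
qed

lemma LR_iff:
  assumes "M \<in> carrier (rat_group_algebra G)"
    and M: "M = M \<otimes>\<^bsub>rat_group_algebra G\<^esub> central_idem G \<chi>"
  shows "M \<in> LR G \<alpha> \<chi> \<longleftrightarrow> lin_ext M * conjugate_sum = 0\<^sub>m n n"
proof -
  let ?\<theta> = "lin_comb (carrier G) (\<lambda>g. g \<alpha>) (\<lambda>g. group_elt (inv g))"
  have "M \<in> LR G \<alpha> \<chi> \<longleftrightarrow> M \<star> ?\<theta> = (\<lambda>x. 0)"
    using assms by (simp add: LR_def mult_group_algebra zero_group_algebra)
  also have "\<dots> \<longleftrightarrow> lin_ext M * lin_ext ?\<theta> = 0\<^sub>m n n"
    using M unfolding mult_group_algebra by (rule convolution_eq_zero_iff)
  also have "lin_ext ?\<theta> = conjugate_sum"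
    by (simp add: conjugate_sum_eq_lin_ext lin_ext_def lin_comb_group_elt_inv[OF finite_carrier])
  finally show ?thesis .
qed

end

theorem theorem3p2:
  fixes f :: "int poly" and \<alpha> :: complex
    and G :: "(complex \<Rightarrow> complex) monoid"
    and \<chi> :: "(complex \<Rightarrow> complex) \<Rightarrow> complex"
    and n :: nat
    and A :: "(complex \<Rightarrow> complex) \<Rightarrow> rat mat"
    and \<mm> :: "((complex \<Rightarrow> complex) \<Rightarrow> complex) set"
    and w :: "nat \<Rightarrow> (complex \<Rightarrow> complex) \<Rightarrow> complex"
    and v :: "nat \<Rightarrow> nat \<Rightarrow> (complex \<Rightarrow> complex) \<Rightarrow> complex"
    and M :: "(complex \<Rightarrow> complex) \<Rightarrow> complex"
    and m :: "rat mat"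
  assumes "lead_coeff f = 1" and "irreducible f"
    and "poly (map_poly of_int f) \<alpha> = 0"
    and "galois_over_rat (adjoin_rat \<alpha>)"
    and "G = galois_group (adjoin_rat \<alpha>)"
    and "absolutely_irreducible_character G \<chi>"
    and "\<chi> \<one>\<^bsub>G\<^esub> = of_nat n"
    and "A \<in> hom G (GL n)"
    and "\<forall>g \<in> carrier G. \<chi> g = of_rat (mat_trace (A g))"
    and "minimal_left_ideal \<mm> (block_algebra G \<chi>)"
    and "rat_basis {..<n} w \<mm>"
    and "\<forall>g \<in> carrier G. \<forall>j<n.
           group_elt g \<otimes>\<^bsub>rat_group_algebra G\<^esub> w j = lin_comb {..<n} (\<lambda>i. of_rat (A g $$ (i, j))) w"
    and "\<forall>i<n. \<forall>j<n. v i j \<in> carrier (block_algebra G \<chi>)"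
    and "\<forall>i<n. \<forall>j<n. \<forall>k<n.
           v i j \<otimes>\<^bsub>rat_group_algebra G\<^esub> w k = (if i = k then w j else \<zero>\<^bsub>rat_group_algebra G\<^esub>)"
    and "M \<in> carrier (rat_group_algebra G)"
    and "M = M \<otimes>\<^bsub>rat_group_algebra G\<^esub> central_idem G \<chi>"
    and "m \<in> carrier_mat n n"
    and "M = lin_comb ({..<n} \<times> {..<n}) (\<lambda>(k, l). of_rat (m $$ (k, l))) (\<lambda>(k, l). v l k)"
  shows "rat_basis ({..<n} \<times> {..<n}) (\<lambda>(i, j). v i j) (carrier (block_algebra G \<chi>)) \<and>
         (M \<in> LR G \<alpha> \<chi> \<longleftrightarrow> map_mat of_rat m * conjugate_sum_mat G \<alpha> n A = 0\<^sub>m n n) \<and>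
         (map_mat of_rat m * conjugate_sum_mat G \<alpha> n A = 0\<^sub>m n n \<longleftrightarrow>
          map_mat of_rat m *\<^sub>v col (conjugate_sum_mat G \<alpha> n A) 0 = 0\<^sub>v n)"
proof -
  let ?K = "adjoin_rat \<alpha>"
  interpret K: rat_subalgebra ?K by (rule rat_subalgebra_adjoin_rat)
  have "algebraic \<alpha>"
    using assms(1,3) by (intro algebraicI[of "map_poly of_int f"]) auto
  then have "finite (carrier G)"
    by (simp add: assms(5) K.carrier_galois_group finite_field_auts_adjoin_rat)
  then have rep: "complex_rep G n (\<lambda>g. map_mat of_rat (A g)) \<chi>"
    using assms(8,9) K.group_galois_group by (intro complex_rep_of_rat) (simp_all add: assms(5))
  interpret galois_block ?K G n A \<chi> \<mm> w v \<alpha>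
    by (intro galois_block.intro galois_block_axioms.intro block_matrix_units.intro
        block_matrix_units_axioms.intro) (fact rep assms rat_subalgebra_adjoin_rat in_adjoin_rat)+
  have "lin_ext M = map_mat of_rat m"
    unfolding assms(18) by (rule lin_ext_coordinates[OF assms(17)])
  then show ?thesis
    using block_basis LR_iff[OF assms(15,16)] rat_mult_conjugate_sum_eq_0_iff[OF assms(17)] by simp
qed

end
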